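(* For every fixed base set $A$, the mappings $\mathbb L$ and $\mathbb R$ are mutually inverse bijections between the set of all specific RLSEs with base set $A$ and the set of all orthomodular lattices with base set $A$.
   Context: A ring-like structure of events (RLSE) is an algebra $(R,+,\cdot,0,1)$ of type $(2,2,0,0)$ such that $(R,\cdot,0,1)$ is a bounded meet-semilattice (i.e. $\cdot$ is associative, commutative and idempotent, $x0=0$ and $x1=x$ for all $x$) and the following hold for all $x,y\in R$ (multiplication binds more strongly than addition): (R1) $x+y=y+x$; (R2) $(xy+1)(x+1)+1=x$; (R3) $\big((xy+1)x+1\big)x=xy$; (R4) $xy+(x+1)=(xy+1)x+1$. An RLSE is called specific if in addition (R5) $x+y=x(y+1)+(x+1)y$ for all $x,y\in R$. For an algebra $\mathbf R=(R,+,\cdot,0,1)$ of type $(2,2,0,0)$, $\mathbb L(\mathbf R)$ denotes the algebra $(R,\vee,\wedge,{}',0,1)$ with $x\vee y:=(x+1)(y+1)+1$, $x\wedge y:=xy$, $x':=x+1$. For an algebra $\mathbf L=(L,\vee,\wedge,{}',0,1)$ of type $(2,2,1,0,0)$, $\mathbb R(\mathbf L)$ denotes the algebra $(L,+,\cdot,0,1)$ with $x+y:=(x\wedge y')\vee(x'\wedge y)$ and $xy:=x\wedge y$. An orthomodular lattice $(L,\vee,\wedge,{}',0,1)$ is a bounded lattice with an antitone involution $'$ that is a complementation, such that $x\le y$ implies $y=x\vee(y\wedge x')$. *)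

theory Defs
  imports "HOL-Algebra.Ring" "HOL-Library.Complemented_Lattices"
begin

text \<open>
  Algebras of type (2,2,0,0) are represented by the record type \<open>'a ring\<close> of HOL-Algebra; only
  the signature is used here, none of the ring axioms is assumed.  Binary operations are required
  to lie in \<open>A \<rightarrow>\<^sub>E A \<rightarrow>\<^sub>E A\<close>, \<open>A\<close> being the base set: they are closed, and
  they take the default value outside \<open>A\<close>.  Equality of two records is therefore equality of the
  two algebras.
\<close>

locale rlse =
  fixes R :: "'a ring" (structure)
  assumes add_type: "add R \<in> carrier R \<rightarrow>\<^sub>E carrier R \<rightarrow>\<^sub>E carrier R"
    and mult_type: "mult R \<in> carrier R \<rightarrow>\<^sub>E carrier R \<rightarrow>\<^sub>E carrier R"
    and zero_type: "\<zero> \<in> carrier R"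
    and one_type: "\<one> \<in> carrier R"
    and mult_assoc: "\<lbrakk>x \<in> carrier R; y \<in> carrier R; z \<in> carrier R\<rbrakk> \<Longrightarrow>
          (x \<otimes> y) \<otimes> z = x \<otimes> (y \<otimes> z)"
    and mult_comm: "\<lbrakk>x \<in> carrier R; y \<in> carrier R\<rbrakk> \<Longrightarrow> x \<otimes> y = y \<otimes> x"
    and mult_idem: "x \<in> carrier R \<Longrightarrow> x \<otimes> x = x"
    and mult_zero: "x \<in> carrier R \<Longrightarrow> x \<otimes> \<zero> = \<zero>"
    and mult_one: "x \<in> carrier R \<Longrightarrow> x \<otimes> \<one> = x"
    and R1: "\<lbrakk>x \<in> carrier R; y \<in> carrier R\<rbrakk> \<Longrightarrow> x \<oplus> y = y \<oplus> x"
    and R2: "\<lbrakk>x \<in> carrier R; y \<in> carrier R\<rbrakk> \<Longrightarrow>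
          (x \<otimes> y \<oplus> \<one>) \<otimes> (x \<oplus> \<one>) \<oplus> \<one> = x"
    and R3: "\<lbrakk>x \<in> carrier R; y \<in> carrier R\<rbrakk> \<Longrightarrow>
          ((x \<otimes> y \<oplus> \<one>) \<otimes> x \<oplus> \<one>) \<otimes> x = x \<otimes> y"
    and R4: "\<lbrakk>x \<in> carrier R; y \<in> carrier R\<rbrakk> \<Longrightarrow>
          x \<otimes> y \<oplus> (x \<oplus> \<one>) = (x \<otimes> y \<oplus> \<one>) \<otimes> x \<oplus> \<one>"

locale specific_rlse = rlse +
  assumes R5: "\<lbrakk>x \<in> carrier R; y \<in> carrier R\<rbrakk> \<Longrightarrow>
          x \<oplus> y = x \<otimes> (y \<oplus> \<one>) \<oplus> (x \<oplus> \<one>) \<otimes> y"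

definition specific_rlses_on :: "'a set \<Rightarrow> 'a ring set" where
  "specific_rlses_on A = {R. specific_rlse R \<and> carrier R = A}"

record 'a lat_alg = "'a partial_object" +
  ljoin :: "'a \<Rightarrow> 'a \<Rightarrow> 'a" (infixl \<open>\<^bold>\<or>\<index>\<close> 65)
  lmeet :: "'a \<Rightarrow> 'a \<Rightarrow> 'a" (infixl \<open>\<^bold>\<and>\<index>\<close> 70)
  lcompl :: "'a \<Rightarrow> 'a" (\<open>\<sim>\<index> _\<close> [80] 80)
  lbot :: 'a (\<open>\<^bold>0\<index>\<close>)
  ltop :: 'a (\<open>\<^bold>1\<index>\<close>)

definition lleq :: "('a, 'b) lat_alg_scheme \<Rightarrow> 'a \<Rightarrow> 'a \<Rightarrow> bool" (infix \<open>\<preceq>\<index>\<close> 50) where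
  "x \<preceq>\<^bsub>L\<^esub> y \<longleftrightarrow> x \<^bold>\<and>\<^bsub>L\<^esub> y = x"

locale oml =
  fixes L :: "'a lat_alg" (structure)
  assumes join_type: "ljoin L \<in> carrier L \<rightarrow>\<^sub>E carrier L \<rightarrow>\<^sub>E carrier L"
    and meet_type: "lmeet L \<in> carrier L \<rightarrow>\<^sub>E carrier L \<rightarrow>\<^sub>E carrier L"
    and compl_type: "lcompl L \<in> carrier L \<rightarrow>\<^sub>E carrier L"
    and bot_type: "\<^bold>0 \<in> carrier L"
    and top_type: "\<^bold>1 \<in> carrier L"
    and join_assoc: "\<lbrakk>x \<in> carrier L; y \<in> carrier L; z \<in> carrier L\<rbrakk> \<Longrightarrow>
          (x \<^bold>\<or> y) \<^bold>\<or> z = x \<^bold>\<or> (y \<^bold>\<or> z)"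
    and meet_assoc: "\<lbrakk>x \<in> carrier L; y \<in> carrier L; z \<in> carrier L\<rbrakk> \<Longrightarrow>
          (x \<^bold>\<and> y) \<^bold>\<and> z = x \<^bold>\<and> (y \<^bold>\<and> z)"
    and join_comm: "\<lbrakk>x \<in> carrier L; y \<in> carrier L\<rbrakk> \<Longrightarrow> x \<^bold>\<or> y = y \<^bold>\<or> x"
    and meet_comm: "\<lbrakk>x \<in> carrier L; y \<in> carrier L\<rbrakk> \<Longrightarrow> x \<^bold>\<and> y = y \<^bold>\<and> x"
    and join_absorb: "\<lbrakk>x \<in> carrier L; y \<in> carrier L\<rbrakk> \<Longrightarrow> x \<^bold>\<or> (x \<^bold>\<and> y) = x"
    and meet_absorb: "\<lbrakk>x \<in> carrier L; y \<in> carrier L\<rbrakk> \<Longrightarrow> x \<^bold>\<and> (x \<^bold>\<or> y) = x"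
    and bot_least: "x \<in> carrier L \<Longrightarrow> \<^bold>0 \<preceq> x"
    and top_greatest: "x \<in> carrier L \<Longrightarrow> x \<preceq> \<^bold>1"
    and compl_antitone: "\<lbrakk>x \<in> carrier L; y \<in> carrier L; x \<preceq> y\<rbrakk> \<Longrightarrow> \<sim> y \<preceq> \<sim> x"
    and compl_invol: "x \<in> carrier L \<Longrightarrow> \<sim> \<sim> x = x"
    and join_compl: "x \<in> carrier L \<Longrightarrow> x \<^bold>\<or> \<sim> x = \<^bold>1"
    and meet_compl: "x \<in> carrier L \<Longrightarrow> x \<^bold>\<and> \<sim> x = \<^bold>0"
    and orthomodular: "\<lbrakk>x \<in> carrier L; y \<in> carrier L; x \<preceq> y\<rbrakk> \<Longrightarrow> y = x \<^bold>\<or> (y \<^bold>\<and> \<sim> x)"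

definition omls_on :: "'a set \<Rightarrow> 'a lat_alg set" where
  "omls_on A = {L. oml L \<and> carrier L = A}"

text \<open>
  On a whole type this is the type class \<open>orthomodular_lattice\<close> of the library, whose additional
  operations (difference and the two orderings) are determined by the others.
\<close>

lemma oml_UNIV_iff_class:
  fixes L :: "'a lat_alg" (structure)
  assumes "carrier L = UNIV"
  shows "oml L \<longleftrightarrow> class.orthomodular_lattice (\<lambda>x y. x \<^bold>\<and> \<sim> y) (lcompl L) (lmeet L)
           (\<lambda>x y. x \<preceq> y) (\<lambda>x y. x \<preceq> y \<and> x \<noteq> y) (ljoin L) \<^bold>0 \<^bold>1"
    (is "_ \<longleftrightarrow> ?C")
proof
  assume "oml L"
  then interpret oml L .
  have c: "x \<in> carrier L" for x using assms by simp
  note j = join_assoc[OF c c c] join_comm[OF c c] join_absorb[OF c c]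
  note m = meet_assoc[OF c c c] meet_comm[OF c c] meet_absorb[OF c c]
  have idem: "x \<^bold>\<and> x = x" for x by (metis j(3) m(3))
  have le_join: "x \<^bold>\<and> y = x \<longleftrightarrow> x \<^bold>\<or> y = y" for x y by (metis j(2,3) m(2,3))
  show ?C
  proof (unfold_locales, unfold lleq_def)
    show "x \<^bold>\<and> z = x" if "x \<^bold>\<and> y = x" "y \<^bold>\<and> z = y" for x y z using that by (metis m(1))
    show "(x \<^bold>\<and> y) \<^bold>\<and> x = x \<^bold>\<and> y" "(x \<^bold>\<and> y) \<^bold>\<and> y = x \<^bold>\<and> y" for x y by (metis m(1,2) idem)+
    show "x \<^bold>\<and> (y \<^bold>\<and> z) = x" if "x \<^bold>\<and> y = x" "x \<^bold>\<and> z = x" for x y z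
      using that by (metis m(1))
    show "y \<^bold>\<and> (x \<^bold>\<or> y) = y" for x y by (metis j(2) m(3))
    show "(y \<^bold>\<or> z) \<^bold>\<and> x = y \<^bold>\<or> z" if "y \<^bold>\<and> x = y" "z \<^bold>\<and> x = z" for x y z
      using that unfolding le_join by (metis j(1))
    show "x \<^bold>\<or> \<sim> x \<^bold>\<and> y = y" if "x \<^bold>\<and> y = x" for x y
      using orthomodular[OF c c, of x y] that by (simp add: lleq_def m(2))
    show "x = y" if "x \<^bold>\<and> y = x" "y \<^bold>\<and> x = y" for x y using that by (metis m(2))
    show "(x \<^bold>\<and> y = x \<and> x \<noteq> y) = (x \<^bold>\<and> y = x \<and> y \<^bold>\<and> x \<noteq> y)" for x y
      by (metis m(2))
    show "\<sim> y \<^bold>\<and> \<sim> x = \<sim> y" if "x \<^bold>\<and> y = x" for x y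
      using compl_antitone[OF c c, of x y] that by (simp add: lleq_def)
  qed (use idem m(3) bot_least[OF c] top_greatest[OF c] compl_invol[OF c]
      join_compl[OF c] meet_compl[OF c] in \<open>auto simp: lleq_def\<close>)
next
  assume ?C
  then interpret C: orthomodular_lattice "\<lambda>x y. x \<^bold>\<and> \<sim> y" "lcompl L" "lmeet L"
    "\<lambda>x y. x \<preceq> y" "\<lambda>x y. x \<preceq> y \<and> x \<noteq> y" "ljoin L" "\<^bold>0" "\<^bold>1" .
  show "oml L"
  proof unfold_locales
    show "y = x \<^bold>\<or> (y \<^bold>\<and> \<sim> x)" if "x \<preceq> y" for x y
      using C.orthomodular[OF that] by (simp add: C.inf.commute)
  qed (auto simp: assms C.inf.assoc C.sup.assoc C.ortho_antimono intro: C.inf.commute C.sup.commute)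
qed

definition LL :: "'a ring \<Rightarrow> 'a lat_alg" where
  "LL R = \<lparr>carrier = carrier R,
     ljoin = (\<lambda>x\<in>carrier R. \<lambda>y\<in>carrier R.
                (x \<oplus>\<^bsub>R\<^esub> \<one>\<^bsub>R\<^esub>) \<otimes>\<^bsub>R\<^esub> (y \<oplus>\<^bsub>R\<^esub> \<one>\<^bsub>R\<^esub>) \<oplus>\<^bsub>R\<^esub> \<one>\<^bsub>R\<^esub>),
     lmeet = (\<lambda>x\<in>carrier R. \<lambda>y\<in>carrier R. x \<otimes>\<^bsub>R\<^esub> y),
     lcompl = (\<lambda>x\<in>carrier R. x \<oplus>\<^bsub>R\<^esub> \<one>\<^bsub>R\<^esub>),
     lbot = \<zero>\<^bsub>R\<^esub>,
     ltop = \<one>\<^bsub>R\<^esub>\<rparr>"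

definition RR :: "'a lat_alg \<Rightarrow> 'a ring" where
  "RR L = \<lparr>carrier = carrier L,
     mult = (\<lambda>x\<in>carrier L. \<lambda>y\<in>carrier L. x \<^bold>\<and>\<^bsub>L\<^esub> y),
     one = \<^bold>1\<^bsub>L\<^esub>,
     zero = \<^bold>0\<^bsub>L\<^esub>,
     add = (\<lambda>x\<in>carrier L. \<lambda>y\<in>carrier L.
              (x \<^bold>\<and>\<^bsub>L\<^esub> \<sim>\<^bsub>L\<^esub> y) \<^bold>\<or>\<^bsub>L\<^esub> (\<sim>\<^bsub>L\<^esub> x \<^bold>\<and>\<^bsub>L\<^esub> y))\<rparr>"

end

(* Write x' for x + 1. In an RLSE, (R2) says that ' is an antitone involution, so L(R) is a lattice;
   (R3) is the dual form of the orthomodular law, and y = 0 in it gives complementation. (R4) says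
   that x + y is the join of x and y whenever x and y are orthogonal. Since xy' and x'y are orthogonal,
   (R5) then states that x + y is the join of xy' and x'y, so that + is recovered from L(R). *)

theory Submission
  imports Defs
begin

text \<open>A curried operation is extensional in each argument separately, so
  \<open>PiE_ext\<close> is applied twice. Equality of record fields is thereby reduced to agreement
  on the base set.\<close>

lemma PiE2_ext:
  assumes "f \<in> A \<rightarrow>\<^sub>E B \<rightarrow>\<^sub>E C" "g \<in> A \<rightarrow>\<^sub>E B \<rightarrow>\<^sub>E C"
    and "\<And>x y. \<lbrakk>x \<in> A; y \<in> B\<rbrakk> \<Longrightarrow> f x y = g x y"
  shows "f = g"
  using assms(1,2)
proof (rule PiE_ext)
  fix x assume x: "x \<in> A"
  from PiE_mem[OF assms(1) x] PiE_mem[OF assms(2) x] show "f x = g x"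
    by (rule PiE_ext) (rule assms(3)[OF x])
qed

section \<open>From ring-like structures of events to orthomodular lattices\<close>

context rlse
begin

lemma add_closed [simp]: "\<lbrakk>x \<in> carrier R; y \<in> carrier R\<rbrakk> \<Longrightarrow> x \<oplus> y \<in> carrier R"
  using add_type by (blast dest: PiE_mem)

lemma mult_closed [simp]: "\<lbrakk>x \<in> carrier R; y \<in> carrier R\<rbrakk> \<Longrightarrow> x \<otimes> y \<in> carrier R"
  using mult_type by (blast dest: PiE_mem)

declare zero_type [simp] one_type [simp]

lemma neg_neg [simp]: "x \<in> carrier R \<Longrightarrow> x \<oplus> \<one> \<oplus> \<one> = x"
  using R2[of x x] by (simp add: mult_idem)

text \<open>As x <= y means xy = x, (R2) at the pair y, x becomes (x'y')' = y; one more complement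
  gives y' <= x'.\<close>

lemma neg_antimono:
  assumes "x \<in> carrier R" "y \<in> carrier R" "x \<otimes> y = x"
  shows "(y \<oplus> \<one>) \<otimes> (x \<oplus> \<one>) = y \<oplus> \<one>"
proof -
  have "(x \<oplus> \<one>) \<otimes> (y \<oplus> \<one>) \<oplus> \<one> = y"
    using R2[of y x] assms by (simp add: mult_comm)
  then have "(x \<oplus> \<one>) \<otimes> (y \<oplus> \<one>) = y \<oplus> \<one>"
    using neg_neg[of "(x \<oplus> \<one>) \<otimes> (y \<oplus> \<one>)"] assms by simp
  then show ?thesis
    using assms by (simp add: mult_comm)
qed

lemma zero_neg [simp]: "\<zero> \<oplus> \<one> = \<one>"
proof -
  \<comment> \<open>0 lies below 1', so antitony puts 1'' = 1 below 0', which forces 0' = 1.\<close>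
  have "\<zero> \<otimes> (\<one> \<oplus> \<one>) = \<zero>"
    by (metis mult_comm mult_zero add_closed zero_type one_type)
  from neg_antimono[OF _ _ this] show ?thesis
    by (metis mult_comm mult_one neg_neg add_closed zero_type one_type)
qed

lemma one_neg [simp]: "\<one> \<oplus> \<one> = \<zero>"
  using neg_neg[of \<zero>] by simp

lemma mult_neg: "x \<in> carrier R \<Longrightarrow> x \<otimes> (x \<oplus> \<one>) = \<zero>"
  using R3[of x \<zero>] by (metis mult_comm mult_zero mult_one zero_neg add_closed zero_type one_type)

text \<open>Here (x'y)' is the join of x and y'. The law is (R3) at the pair y, x, where yx =
  x.\<close>

lemma dual_orthomodular:
  assumes "x \<in> carrier R" "y \<in> carrier R" "x \<otimes> y = x"
  shows "((x \<oplus> \<one>) \<otimes> y \<oplus> \<one>) \<otimes> y = x"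
  using R3[of y x] assms by (simp add: mult_comm)

text \<open>This is (R4) at the pair y', x: orthogonality makes the product y'x equal to x, and y''
  is y.\<close>

lemma add_orthogonal:
  assumes "x \<in> carrier R" "y \<in> carrier R" "x \<otimes> (y \<oplus> \<one>) = x"
  shows "x \<oplus> y = (x \<oplus> \<one>) \<otimes> (y \<oplus> \<one>) \<oplus> \<one>"
  using R4[of "y \<oplus> \<one>" x] assms by (simp add: mult_comm)

lemma carrier_LL [simp]: "carrier (LL R) = carrier R"
  and join_LL: "\<lbrakk>x \<in> carrier R; y \<in> carrier R\<rbrakk> \<Longrightarrow>
    x \<^bold>\<or>\<^bsub>LL R\<^esub> y = (x \<oplus> \<one>) \<otimes> (y \<oplus> \<one>) \<oplus> \<one>"
  and meet_LL: "\<lbrakk>x \<in> carrier R; y \<in> carrier R\<rbrakk> \<Longrightarrow> x \<^bold>\<and>\<^bsub>LL R\<^esub> y = x \<otimes> y"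
  and compl_LL: "x \<in> carrier R \<Longrightarrow> \<sim>\<^bsub>LL R\<^esub> x = x \<oplus> \<one>"
  and bot_LL [simp]: "\<^bold>0\<^bsub>LL R\<^esub> = \<zero>"
  and top_LL [simp]: "\<^bold>1\<^bsub>LL R\<^esub> = \<one>"
  by (simp_all add: LL_def)

lemmas LL_simps = join_LL meet_LL compl_LL lleq_def

text \<open>The case numbers follow the order of the assumptions of \<open>oml\<close>: 10 and 11
  are the absorption laws, the first being (R2) itself, 14 is antitony and 18 the orthomodular
  law.\<close>

lemma oml_LL: "oml (LL R)"
proof (unfold_locales, goal_cases)
  case 1
  show ?case by (simp add: LL_def)
next
  case 2
  show ?case by (simp add: LL_def)
next
  case 3
  show ?case by (simp add: LL_def)
next
  case (6 x y z)
  then show ?case by (simp add: LL_simps mult_assoc)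
next
  case (7 x y z)
  then show ?case by (simp add: LL_simps mult_assoc)
next
  case (10 x y)
  then show ?case
    using R2[of x y] by (simp add: LL_simps mult_comm)
next
  case (11 x y)
  \<comment> \<open>Since x'y' <= x', antitony gives x <= (x'y')'.\<close>
  then have "x \<otimes> ((x \<oplus> \<one>) \<otimes> (y \<oplus> \<one>) \<oplus> \<one>) = x"
    using neg_antimono[of "(x \<oplus> \<one>) \<otimes> (y \<oplus> \<one>)" "x \<oplus> \<one>"]
    by (simp add: mult_comm) (metis add_closed mult_assoc mult_idem one_type)
  with 11 show ?case by (simp add: LL_simps)
next
  case (14 x y)
  then show ?case
    using neg_antimono[of x y] by (simp add: LL_simps)
next
  case (18 x y)
  \<comment> \<open>Antitony turns x <= y into y' <= x'; the complement of the dual law for this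
    pair is the equation.\<close>
  then have "y = (x \<oplus> \<one>) \<otimes> (y \<otimes> (x \<oplus> \<one>) \<oplus> \<one>) \<oplus> \<one>"
    using dual_orthomodular[of "y \<oplus> \<one>" "x \<oplus> \<one>"] neg_antimono[of x y]
    by (simp add: LL_simps mult_comm)
  with 18 show ?case by (simp add: LL_simps)
qed (auto simp: LL_simps mult_zero mult_one mult_neg mult_comm)

end

section \<open>From orthomodular lattices to specific ring-like structures of events\<close>

context oml
begin

lemma join_closed [simp]: "\<lbrakk>x \<in> carrier L; y \<in> carrier L\<rbrakk> \<Longrightarrow> x \<^bold>\<or> y \<in> carrier L"
  using join_type by (blast dest: PiE_mem)

lemma meet_closed [simp]: "\<lbrakk>x \<in> carrier L; y \<in> carrier L\<rbrakk> \<Longrightarrow> x \<^bold>\<and> y \<in> carrier L"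
  using meet_type by (blast dest: PiE_mem)

lemma compl_closed [simp]: "x \<in> carrier L \<Longrightarrow> \<sim> x \<in> carrier L"
  using compl_type by (blast dest: PiE_mem)

declare bot_type [simp] top_type [simp] compl_invol [simp]

lemma meet_idem: "x \<in> carrier L \<Longrightarrow> x \<^bold>\<and> x = x"
  by (metis join_absorb meet_absorb meet_closed)

lemma meet_bot: "x \<in> carrier L \<Longrightarrow> x \<^bold>\<and> \<^bold>0 = \<^bold>0"
  using bot_least by (simp add: lleq_def meet_comm)

lemma meet_top: "x \<in> carrier L \<Longrightarrow> x \<^bold>\<and> \<^bold>1 = x"
  using top_greatest by (simp add: lleq_def)

lemma bot_join: "x \<in> carrier L \<Longrightarrow> \<^bold>0 \<^bold>\<or> x = x"
  by (metis join_comm join_absorb meet_bot bot_type)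

lemma meet_meet_left: "\<lbrakk>x \<in> carrier L; y \<in> carrier L\<rbrakk> \<Longrightarrow> x \<^bold>\<and> y \<preceq> x"
  unfolding lleq_def by (metis meet_assoc meet_comm meet_idem)

lemma le_iff_join: "\<lbrakk>x \<in> carrier L; y \<in> carrier L\<rbrakk> \<Longrightarrow> x \<preceq> y \<longleftrightarrow> x \<^bold>\<or> y = y"
  unfolding lleq_def by (metis join_comm join_absorb meet_comm meet_absorb)

lemma compl_le_iff: "\<lbrakk>x \<in> carrier L; y \<in> carrier L\<rbrakk> \<Longrightarrow> \<sim> y \<preceq> \<sim> x \<longleftrightarrow> x \<preceq> y"
  by (metis compl_antitone compl_invol compl_closed)

text \<open>Joins in \<open>LL (RR L)\<close> have the form of the left-hand side, so recovering
  \<open>L\<close> rests on this. The proof is by antisymmetry: the complement of the join is a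
  lower bound of x' and y', and the complement of their meet is an upper bound of x and y.\<close>

lemma de_Morgan:
  assumes [simp]: "x \<in> carrier L" "y \<in> carrier L"
  shows "\<sim> (\<sim> x \<^bold>\<and> \<sim> y) = x \<^bold>\<or> y"
proof -
  have anti: "\<sim> v \<^bold>\<and> \<sim> u = \<sim> v"
    if "u \<in> carrier L" "v \<in> carrier L" "u \<^bold>\<and> v = u" for u v
    using compl_antitone[of u v] that by (simp add: lleq_def)
  let ?j = "x \<^bold>\<or> y" and ?m = "\<sim> x \<^bold>\<and> \<sim> y"
  have "\<sim> ?j \<^bold>\<and> \<sim> x = \<sim> ?j" "\<sim> ?j \<^bold>\<and> \<sim> y = \<sim> ?j"
    using anti[of x ?j] anti[of y ?j] meet_absorb[of x y] meet_absorb[of y x]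
    by (simp_all add: join_comm)
  then have "\<sim> ?j \<^bold>\<and> ?m = \<sim> ?j"
    by (simp add: meet_assoc[symmetric])
  then have 1: "\<sim> ?m \<^bold>\<and> ?j = \<sim> ?m"
    using anti[of "\<sim> ?j" ?m] by simp
  have "x \<^bold>\<or> \<sim> ?m = \<sim> ?m"
    using meet_meet_left[of "\<sim> x" "\<sim> y"] compl_le_iff[of x "\<sim> ?m"] le_iff_join[of x "\<sim> ?m"]
    by simp
  moreover have "y \<^bold>\<or> \<sim> ?m = \<sim> ?m"
    using meet_meet_left[of "\<sim> y" "\<sim> x"] compl_le_iff[of y "\<sim> ?m"] le_iff_join[of y "\<sim> ?m"]
    by (simp add: meet_comm)
  ultimately have "?j \<^bold>\<or> \<sim> ?m = \<sim> ?m"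
    by (simp add: join_assoc)
  then have "?j \<^bold>\<and> \<sim> ?m = ?j"
    by (metis assms meet_absorb join_closed meet_closed compl_closed)
  with 1 show ?thesis
    by (metis assms meet_comm join_closed meet_closed compl_closed)
qed

lemma compl_top: "\<sim> \<^bold>1 = \<^bold>0"
  using meet_compl[of "\<^bold>1"] by (metis meet_comm meet_top top_type compl_closed)

text \<open>Adding 1 in \<open>RR L\<close> is complementation. The sum is written out so that the
  rule still applies after \<open>add_RR\<close> has expanded x + 1, as in the check of
  (R5).\<close>

lemma sum_top: "x \<in> carrier L \<Longrightarrow> (x \<^bold>\<and> \<sim> \<^bold>1) \<^bold>\<or> (\<sim> x \<^bold>\<and> \<^bold>1) = \<sim> x"
  by (simp add: compl_top meet_bot meet_top bot_join)

text \<open>Orthogonality is symmetric: y <= x' holds as well, so the two meets collapse to x and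
  y.\<close>

lemma sum_orthogonal:
  assumes "x \<in> carrier L" "y \<in> carrier L" "x \<preceq> \<sim> y"
  shows "(x \<^bold>\<and> \<sim> y) \<^bold>\<or> (\<sim> x \<^bold>\<and> y) = x \<^bold>\<or> y"
  using assms compl_antitone[of x "\<sim> y"] by (simp add: lleq_def meet_comm)

lemma carrier_RR [simp]: "carrier (RR L) = carrier L"
  and mult_RR: "\<lbrakk>x \<in> carrier L; y \<in> carrier L\<rbrakk> \<Longrightarrow> x \<otimes>\<^bsub>RR L\<^esub> y = x \<^bold>\<and> y"
  and add_RR: "\<lbrakk>x \<in> carrier L; y \<in> carrier L\<rbrakk> \<Longrightarrow>
    x \<oplus>\<^bsub>RR L\<^esub> y = (x \<^bold>\<and> \<sim> y) \<^bold>\<or> (\<sim> x \<^bold>\<and> y)"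
  and one_RR [simp]: "\<one>\<^bsub>RR L\<^esub> = \<^bold>1"
  and zero_RR [simp]: "\<zero>\<^bsub>RR L\<^esub> = \<^bold>0"
  by (simp_all add: RR_def)

lemma add_one_RR: "x \<in> carrier L \<Longrightarrow> x \<oplus>\<^bsub>RR L\<^esub> \<^bold>1 = \<sim> x"
  by (simp add: add_RR sum_top)

text \<open>Cases 11 to 14 are (R2) to (R5), in this order.\<close>

lemma specific_rlse_RR: "specific_rlse (RR L)"
proof (unfold_locales, goal_cases)
  case 1
  show ?case by (simp add: RR_def)
next
  case 2
  show ?case by (simp add: RR_def)
next
  case (5 x y z)
  then show ?case by (simp add: mult_RR meet_assoc)
next
  case (11 x y)
  then have "\<sim> (x \<^bold>\<and> y) \<^bold>\<and> \<sim> x = \<sim> x"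
    using compl_antitone[OF _ _ meet_meet_left, of x y] by (simp add: lleq_def meet_comm)
  with 11 show ?case by (simp add: mult_RR add_one_RR)
next
  case (12 x y)
  let ?z = "x \<^bold>\<and> y"
  \<comment> \<open>The orthomodular law for x' <= (xy)'; its complement is (R3).\<close>
  have "\<sim> ?z = \<sim> x \<^bold>\<or> (\<sim> ?z \<^bold>\<and> x)"
    using 12 orthomodular[of "\<sim> x" "\<sim> ?z"] compl_antitone[OF _ _ meet_meet_left, of x y] by simp
  then have "\<sim> (x \<^bold>\<and> \<sim> (\<sim> ?z \<^bold>\<and> x)) = \<sim> ?z"
    using 12 de_Morgan[of "\<sim> x" "\<sim> ?z \<^bold>\<and> x"] by simp
  \<comment> \<open>The extra complement on both sides lets the preceding equation rewrite the goal;
    the involution law removes it afterwards.\<close>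
  then have "\<sim> \<sim> (\<sim> (\<sim> ?z \<^bold>\<and> x) \<^bold>\<and> x) = \<sim> \<sim> ?z"
    using 12 by (simp only: meet_comm carrier_RR meet_closed compl_closed)
  with 12 show ?case by (simp add: mult_RR add_one_RR)
next
  case (13 x y)
  \<comment> \<open>As xy <= x = x'', the elements xy and x' are orthogonal and their sum is a
    join.\<close>
  then show ?case
    using sum_orthogonal[of "x \<^bold>\<and> y" "\<sim> x"] de_Morgan[of "x \<^bold>\<and> y" "\<sim> x"]
    by (simp add: mult_RR add_one_RR add_RR[of "x \<^bold>\<and> y"] meet_meet_left)
next
  case (14 x y)
  let ?p = "x \<^bold>\<and> \<sim> y" and ?q = "\<sim> x \<^bold>\<and> y"
  \<comment> \<open>From \<open>?q\<close> <= x' follows x <= \<open>?q\<close>', and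
    \<open>?p\<close> <= x makes \<open>?p\<close> and \<open>?q\<close> orthogonal. Their sum is
    then their join, which is how x + y is defined.\<close>
  have "x \<^bold>\<and> \<sim> ?q = x"
    using 14 compl_antitone[OF _ _ meet_meet_left, of "\<sim> x" y] by (simp add: lleq_def)
  then have "?p \<preceq> \<sim> ?q"
    using 14 meet_assoc[of "\<sim> y" x "\<sim> ?q"] by (simp add: lleq_def meet_comm[of x "\<sim> y"])
  with 14 show ?case
    using sum_orthogonal[of ?p ?q] by (simp add: mult_RR add_RR sum_top)
qed (auto simp: mult_RR add_RR meet_idem meet_bot meet_top join_comm meet_comm)

text \<open>Record equality includes the values off the base set; \<open>L'\<close> is interpreted
  to supply the extensional types of the operations of \<open>LL (RR L)\<close>.\<close>

lemma LL_RR: "LL (RR L) = L"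
proof (rule lat_alg.equality)
  interpret R: specific_rlse "RR L" by (rule specific_rlse_RR)
  interpret L': oml "LL (RR L)" by (rule R.oml_LL)
  show "ljoin (LL (RR L)) = ljoin L"
    by (rule PiE2_ext[OF L'.join_type[simplified] join_type])
       (simp add: R.LL_simps mult_RR add_one_RR de_Morgan)
  show "lmeet (LL (RR L)) = lmeet L"
    by (rule PiE2_ext[OF L'.meet_type[simplified] meet_type]) (simp add: R.LL_simps mult_RR)
  show "lcompl (LL (RR L)) = lcompl L"
    by (rule PiE_ext[OF L'.compl_type[simplified] compl_type]) (simp add: R.LL_simps add_one_RR)
qed (simp_all add: LL_def)

end

lemma (in specific_rlse) RR_LL: "RR (LL R) = R"
proof (rule ring.equality)
  \<comment> \<open>The right-hand side is the symmetric difference formed in \<open>LL R\<close>,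
    its join expressed by products and complements.\<close>
  have sum: "x \<oplus> y = (x \<otimes> (y \<oplus> \<one>) \<oplus> \<one>) \<otimes> ((x \<oplus> \<one>) \<otimes> y \<oplus> \<one>) \<oplus> \<one>"
    if "x \<in> carrier R" "y \<in> carrier R" for x y
  proof -
    let ?p = "x \<otimes> (y \<oplus> \<one>)" and ?q = "(x \<oplus> \<one>) \<otimes> y"
    \<comment> \<open>The orthogonality argument in the language of products: \<open>?q\<close> <=
      x' gives x <= \<open>?q\<close>', and \<open>?p\<close> <= x.\<close>
    have "?q \<otimes> (x \<oplus> \<one>) = ?q"
      using that by (metis add_closed mult_assoc mult_comm mult_idem one_type)
    then have "x \<otimes> (?q \<oplus> \<one>) = x"
      using neg_antimono[of ?q "x \<oplus> \<one>"] that by simp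
    then have "?p \<otimes> (?q \<oplus> \<one>) = ?p"
      using that mult_assoc[of "y \<oplus> \<one>" x "?q \<oplus> \<one>"]
      by (simp add: mult_comm[of x "y \<oplus> \<one>"])
    then show ?thesis
      using add_orthogonal[of ?p ?q] R5[of x y] that by simp
  qed
  interpret L: oml "LL R" by (rule oml_LL)
  interpret R': specific_rlse "RR (LL R)" by (rule L.specific_rlse_RR)
  show "add (RR (LL R)) = add R"
    by (rule PiE2_ext[OF R'.add_type[simplified] add_type])
       (simp add: L.add_RR LL_simps sum[symmetric])
  show "mult (RR (LL R)) = mult R"
    by (rule PiE2_ext[OF R'.mult_type[simplified] mult_type]) (simp add: L.mult_RR LL_simps)
qed (simp_all add: RR_def LL_def)

theorem corollary2p5:
  fixes A :: "'a set"
  shows "bij_betw LL (specific_rlses_on A) (omls_on A) \<and>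
         bij_betw RR (omls_on A) (specific_rlses_on A) \<and>
         (\<forall>R \<in> specific_rlses_on A. RR (LL R) = R) \<and>
         (\<forall>L \<in> omls_on A. LL (RR L) = L)"
proof -
  have "LL ` specific_rlses_on A \<subseteq> omls_on A"
    by (auto simp: specific_rlses_on_def omls_on_def specific_rlse_def rlse.oml_LL)
       (simp_all add: LL_def)
  moreover have "RR ` omls_on A \<subseteq> specific_rlses_on A"
    by (auto simp: specific_rlses_on_def omls_on_def oml.specific_rlse_RR oml.carrier_RR)
  moreover have "\<forall>R \<in> specific_rlses_on A. RR (LL R) = R"
    by (simp add: specific_rlses_on_def specific_rlse.RR_LL)
  moreover have "\<forall>L \<in> omls_on A. LL (RR L) = L"
    by (simp add: omls_on_def oml.LL_RR)
  \<comment> \<open>Each map serves as the witness for the inverse of the other.\<close>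
  ultimately show ?thesis
    by (blast intro: bij_betw_byWitness)
qed

end
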